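(* Let $d,N\in\mathbb{N}$ and let $S\subseteq\mathbb{Z}^d$ be a non-empty subset with $|S|\le N+1$. Let $M(S)\subseteq\mathbb{Z}^d$ be the subgroup generated by all differences $m-m'$ with $m,m'\in S$, let $\Phi:M(S)\to\mathbb{Z}^e$ be any group isomorphism (for the appropriate $e\in\mathbb{N}$), let $m$ be any element of $S$, and put $\tilde S:=\Phi(S-m)\subseteq\mathbb{Z}^e$. Then $X(S)\subseteq\mathbb{P}^N$ is projectively equivalent to $X(\tilde S)\subseteq\mathbb{P}^N$.
   Context: Everything is over $\mathbb{C}$; $\mathbb{P}^N=\mathbb{P}^N(\mathbb{C})$ and $\mathbb{N}$ includes $0$. Two subvarieties $X,X'\subseteq\mathbb{P}^N$ are projectively equivalent if there is $g\in\mathrm{PGL}(N+1)=\mathrm{PGL}(N+1,\mathbb{C})$ with $g(X)=X'$. Here $S-m=\{s-m\mid s\in S\}\subseteq M(S)$. Construction of $X(S)$ (for any $d\in\mathbb{N}$; it is applied both to $S\subseteq\mathbb{Z}^d$ and to $\tilde S\subseteq\mathbb{Z}^e$): let $S\subseteq\mathbb{Z}^d$ be a non-empty subset with $|S|\le N+1$, and enumerate $S=\{m_0,\ldots,m_r\}$ with the $m_i$ distinct (so $r\le N$). For $t=(t_1,\dots,t_d)\in(\mathbb{C}^* )^d$ and $m=(a_1,\dots,a_d)\in\mathbb{Z}^d$ put $t^m=t_1^{a_1}\cdots t_d^{a_d}$. Let $T\subseteq\mathrm{PGL}(N+1)$ be the image of the homomorphism $(\mathbb{C}^* )^d\to\mathrm{PGL}(N+1)$,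 $t\mapsto\mathrm{diag}(t^{m_0},\ldots,t^{m_r},1,\ldots,1)$ (with $N-r$ ones), and let $x=[1:\ldots:1:0:\ldots:0]\in\mathbb{P}^N$ (with $r+1$ ones and $N-r$ zeros). Then $X(S):=\overline{Tx}\subseteq\mathbb{P}^N$. It depends on the enumeration of $S$, but any two enumerations give projectively equivalent subvarieties. *)

theory Defs
  imports
    Complex_Main
    "HOL-Library.Poly_Mapping"
    "Jordan_Normal_Form.Matrix"
    "HOL-Algebra.Coset"
    "HOL-Algebra.Elementary_Groups"
begin

text \<open>
  Dimensions are arbitrary natural numbers, 0 included, so vectors and matrices are the
  carrier-based ones of Jordan_Normal_Form, with indices starting at 0:
  \<open>\<int>\<^sup>d\<close> is \<open>monoid_vec TYPE(int) d\<close>, and coordinates on \<open>\<P>\<^sup>N\<close> are indexed by \<open>0, \<dots>, N\<close>.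
\<close>

section \<open>Projective space and its Zariski topology\<close>

text \<open>A point of projective space is the set of all its homogeneous coordinate vectors.\<close>

definition proj_point :: "complex vec \<Rightarrow> complex vec set" where
  "proj_point v = {c \<cdot>\<^sub>v v | c. c \<noteq> 0}"

definition proj_space :: "nat \<Rightarrow> complex vec set set" where
  "proj_space N = proj_point ` (carrier_vec (Suc N) - {0\<^sub>v (Suc N)})"

text \<open>
  Polynomials map exponent vectors (finitely supported functions from variable indices
  to exponents) to coefficients.
\<close>

type_synonym cpoly = "(nat \<Rightarrow>\<^sub>0 nat) \<Rightarrow>\<^sub>0 complex"

definition homogeneous_poly :: "nat \<Rightarrow> cpoly \<Rightarrow> bool" where
  "homogeneous_poly N f \<longleftrightarrow>
     (\<forall>a \<in> Poly_Mapping.keys f. Poly_Mapping.keys a \<subseteq> {..N}) \<and>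
     (\<exists>k. \<forall>a \<in> Poly_Mapping.keys f. (\<Sum>i \<in> Poly_Mapping.keys a. Poly_Mapping.lookup a i) = k)"

definition poly_value :: "cpoly \<Rightarrow> complex vec \<Rightarrow> complex" where
  "poly_value f v =
     (\<Sum>a \<in> Poly_Mapping.keys f.
        Poly_Mapping.lookup f a * (\<Prod>i \<in> Poly_Mapping.keys a. (v $ i) ^ Poly_Mapping.lookup a i))"

definition zariski_closed :: "nat \<Rightarrow> complex vec set set \<Rightarrow> bool" where
  "zariski_closed N Z \<longleftrightarrow>
     (\<exists>F. (\<forall>f \<in> F. homogeneous_poly N f) \<and>
          Z = {p \<in> proj_space N. \<forall>f \<in> F. \<forall>v \<in> p. poly_value f v = 0})"

definition zariski_closure :: "nat \<Rightarrow> complex vec set set \<Rightarrow> complex vec set set" where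
  "zariski_closure N A = zariski_closed N hull A"

section \<open>The projective linear group\<close>

definition GL :: "nat \<Rightarrow> complex mat monoid" where
  "GL n = units_of (ring_mat TYPE(complex) n ())"

definition scalar_matrices :: "nat \<Rightarrow> complex mat set" where
  "scalar_matrices n = {c \<cdot>\<^sub>m 1\<^sub>m n | c. c \<noteq> 0}"

definition PGL :: "nat \<Rightarrow> complex mat set monoid" where
  "PGL n = GL n Mod scalar_matrices n"

definition PGL_class :: "nat \<Rightarrow> complex mat \<Rightarrow> complex mat set" where
  "PGL_class n A = scalar_matrices n #>\<^bsub>GL n\<^esub> A"

text \<open>
  An element of PGL is a set of matrices and a point is a set of vectors; acting means
  forming all products, which yields the point \<open>[A v]\<close> from the class of \<open>A\<close> and \<open>[v]\<close>.
\<close>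

definition PGL_act :: "complex mat set \<Rightarrow> complex vec set \<Rightarrow> complex vec set" where
  "PGL_act g p = {A *\<^sub>v v | A v. A \<in> g \<and> v \<in> p}"

lemma GL_carrier:
  "A \<in> carrier (GL n) \<longleftrightarrow>
     A \<in> carrier_mat n n \<and> (\<exists>B\<in>carrier_mat n n. A * B = 1\<^sub>m n \<and> B * A = 1\<^sub>m n)"
  by (auto simp: GL_def units_of_def ring_mat_def Units_def)

lemma GL_mult: "mult (GL n) = (*)" "one (GL n) = 1\<^sub>m n"
  by (auto simp: GL_def units_of_def ring_mat_def)

lemma group_GL: "group (GL n)"
proof -
  interpret ring "ring_mat TYPE(complex) n ()" by (rule ring_mat)
  show ?thesis unfolding GL_def by (rule units_group)
qed

lemma PGL_class_eq: "A \<in> carrier_mat n n \<Longrightarrow> PGL_class n A = {c \<cdot>\<^sub>m A |c. c \<noteq> 0}"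
  unfolding PGL_class_def r_coset_def scalar_matrices_def GL_mult
  by auto (metis left_mult_one_mat mult_smult_assoc_mat one_carrier_mat)+

lemma subgroup_scalar_matrices: "subgroup (scalar_matrices n) (GL n)"
proof (rule group.subgroupI[OF group_GL])
  have k: "(a \<cdot>\<^sub>m 1\<^sub>m n) * (b \<cdot>\<^sub>m 1\<^sub>m n) = (a*b) \<cdot>\<^sub>m (1\<^sub>m n :: complex mat)" for a b :: complex
    by (intro eq_matI) (auto simp: mult_smult_assoc_mat[of _ n n _ n])
  have inv1: "c \<cdot>\<^sub>m 1\<^sub>m n \<in> carrier (GL n)" if "c\<noteq>0" for c
    unfolding GL_carrier using that by (auto intro!: bexI[of _ "inverse c \<cdot>\<^sub>m 1\<^sub>m n"] simp: k)
  show "scalar_matrices n \<subseteq> carrier (GL n)" using inv1 by (auto simp: scalar_matrices_def)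
  show "scalar_matrices n \<noteq> {}" by (auto simp: scalar_matrices_def intro: exI[of _ 1])
  fix A B assume A: "A \<in> scalar_matrices n" and B: "B \<in> scalar_matrices n"
  show "A \<otimes>\<^bsub>GL n\<^esub> B \<in> scalar_matrices n" using A B unfolding GL_mult scalar_matrices_def
    by (auto simp: k)
  obtain c where c: "A = c \<cdot>\<^sub>m 1\<^sub>m n" "c \<noteq> 0" using A by (auto simp: scalar_matrices_def)
  have "inv\<^bsub>GL n\<^esub> A = inverse c \<cdot>\<^sub>m 1\<^sub>m n"
    by (rule group.inv_equality[OF group_GL]) (use c inv1 in \<open>auto simp: GL_mult k\<close>)
  then show "inv\<^bsub>GL n\<^esub> A \<in> scalar_matrices n" using c by (auto simp: scalar_matrices_def)
qed

lemma normal_scalar_matrices: "scalar_matrices n \<lhd> GL n"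
  unfolding group.normal_inv_iff[OF group_GL]
proof (safe intro!: subgroup_scalar_matrices)
  interpret group "GL n" by (rule group_GL)
  fix x h assume x: "x \<in> carrier (GL n)" and h: "h \<in> scalar_matrices n"
  then obtain c where c: "h = c \<cdot>\<^sub>m 1\<^sub>m n" "c \<noteq> 0" by (auto simp: scalar_matrices_def)
  have hc: "h \<in> carrier (GL n)" using subgroup_scalar_matrices h by (meson subgroup.mem_carrier)
  have xm: "x \<in> carrier_mat n n" using x GL_carrier by blast
  have "x \<otimes>\<^bsub>GL n\<^esub> h = h \<otimes>\<^bsub>GL n\<^esub> x" unfolding GL_mult c using xm
    by (simp add: mult_smult_assoc_mat[of _ n n _ n] mult_smult_distrib[of _ n n _ n])
  then have "x \<otimes>\<^bsub>GL n\<^esub> h \<otimes>\<^bsub>GL n\<^esub> inv\<^bsub>GL n\<^esub> x = h" using x hc by (simp add: inv_solve_right')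
  then show "x \<otimes>\<^bsub>GL n\<^esub> h \<otimes>\<^bsub>GL n\<^esub> inv\<^bsub>GL n\<^esub> x \<in> scalar_matrices n" using h by simp
qed

lemma group_PGL: "group (PGL n)"
  unfolding PGL_def by (rule normal.factorgroup_is_group[OF normal_scalar_matrices])

lemma PGL_act_class:
  assumes A: "A \<in> carrier_mat n n" and v: "v \<in> carrier_vec n"
  shows "PGL_act (PGL_class n A) (proj_point v) = proj_point (A *\<^sub>v v)"
proof -
  have *: "(c \<cdot>\<^sub>m A) *\<^sub>v (k \<cdot>\<^sub>v v) = (c * k) \<cdot>\<^sub>v (A *\<^sub>v v)" for c k
    using A v by (intro eq_vecI) auto
  show ?thesis unfolding PGL_class_eq[OF A] PGL_act_def proj_point_def
  proof (intro equalityI subsetI; clarsimp simp: *)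
    fix c k :: complex assume "c \<noteq> 0" "k \<noteq> 0"
    then show "\<exists>ca. (c * k) \<cdot>\<^sub>v (A *\<^sub>v v) = ca \<cdot>\<^sub>v (A *\<^sub>v v) \<and> ca \<noteq> 0"
      by (intro exI[of _ "c * k"]) auto
  next
    fix c :: complex assume "c \<noteq> 0"
    then show "\<exists>B w. c \<cdot>\<^sub>v (A *\<^sub>v v) = B *\<^sub>v w \<and>
        (\<exists>c. B = c \<cdot>\<^sub>m A \<and> c \<noteq> 0) \<and> (\<exists>c. w = c \<cdot>\<^sub>v v \<and> c \<noteq> 0)"
      using *[of c 1] by (intro exI[of _ "c \<cdot>\<^sub>m A"] exI[of _ "1 \<cdot>\<^sub>v v"]) (auto intro: exI[of _ 1])
  qed
qed

definition projectively_equivalent ::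
    "nat \<Rightarrow> complex vec set set \<Rightarrow> complex vec set set \<Rightarrow> bool" where
  "projectively_equivalent N X X' \<longleftrightarrow>
     (\<exists>g \<in> carrier (PGL (Suc N)). PGL_act g ` X = X')"

section \<open>The varieties \<open>X(S)\<close>\<close>

definition torus :: "nat \<Rightarrow> complex vec monoid" where
  "torus d = \<lparr>carrier = {t \<in> carrier_vec d. \<forall>i < d. t $ i \<noteq> 0},
              mult = (\<lambda>s t. vec d (\<lambda>i. s $ i * t $ i)),
              one = vec d (\<lambda>_. 1)\<rparr>"

definition torus_monom :: "nat \<Rightarrow> complex vec \<Rightarrow> int vec \<Rightarrow> complex" where
  "torus_monom d t m = (\<Prod>i < d. (t $ i) powi (m $ i))"

text \<open>
  The construction depends on an enumeration of \<open>S\<close>, given here as the list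
  \<open>ms = [m\<^sub>0, \<dots>, m\<^sub>r]\<close>, so that \<open>length ms = r + 1\<close>.
\<close>

definition enumerates :: "'a list \<Rightarrow> 'a set \<Rightarrow> bool" where
  "enumerates ms S \<longleftrightarrow> distinct ms \<and> set ms = S"

definition torus_to_PGL :: "nat \<Rightarrow> nat \<Rightarrow> int vec list \<Rightarrow> complex vec \<Rightarrow> complex mat set" where
  "torus_to_PGL d N ms t =
     PGL_class (Suc N)
       (mat_diag (Suc N) (\<lambda>i. if i < length ms then torus_monom d t (ms ! i) else 1))"

lemma comm_group_torus: "comm_group (torus d)"
  apply (rule comm_groupI)
  apply (auto simp: torus_def intro!: eq_vecI)
  subgoal for x by (rule exI[of _ "vec d (\<lambda>i. inverse (x $ i))"]) (auto)
  done

lemma torus_to_PGL_hom: "torus_to_PGL d N ms \<in> hom (torus d) (PGL (Suc N))"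
proof (rule homI)
  let ?D = "\<lambda>t. mat_diag (Suc N) (\<lambda>i. if i < length ms then torus_monom d t (ms ! i) else 1)"
  have nz: "torus_monom d t m \<noteq> 0" if "t \<in> carrier (torus d)" for t m
    using that by (auto simp: torus_monom_def torus_def)
  have D: "?D t \<in> carrier (GL (Suc N))" if "t \<in> carrier (torus d)" for t
    unfolding GL_carrier using nz[OF that]
    by (auto intro!: bexI[of _ "mat_diag (Suc N) (\<lambda>i. if i < length ms then inverse (torus_monom d t (ms ! i)) else 1)"]
      simp flip: mat_diag_one intro!: arg_cong[of _ _ "mat_diag (Suc N)"] ext)
  { fix t assume "t \<in> carrier (torus d)" then show "torus_to_PGL d N ms t \<in> carrier (PGL (Suc N))"
     using D unfolding torus_to_PGL_def PGL_def PGL_class_def FactGroup_def RCOSETS_def by auto }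
  fix s t assume s: "s \<in> carrier (torus d)" and t: "t \<in> carrier (torus d)"
  have m: "torus_monom d (s \<otimes>\<^bsub>torus d\<^esub> t) m = torus_monom d s m * torus_monom d t m" for m
    by (simp add: torus_monom_def torus_def power_int_mult_distrib prod.distrib)
  have "?D (s \<otimes>\<^bsub>torus d\<^esub> t) = ?D s \<otimes>\<^bsub>GL (Suc N)\<^esub> ?D t"
    by (auto simp: GL_mult m intro!: arg_cong[of _ _ "mat_diag (Suc N)"])
  then show "torus_to_PGL d N ms (s \<otimes>\<^bsub>torus d\<^esub> t) = torus_to_PGL d N ms s \<otimes>\<^bsub>PGL (Suc N)\<^esub> torus_to_PGL d N ms t"
    using normal.rcos_sum[OF normal_scalar_matrices D[OF s] D[OF t]]
    unfolding torus_to_PGL_def PGL_class_def PGL_def by (simp add: FactGroup_def)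
qed

definition torus_image :: "nat \<Rightarrow> nat \<Rightarrow> int vec list \<Rightarrow> complex mat set set" where
  "torus_image d N ms = torus_to_PGL d N ms ` carrier (torus d)"

definition base_point :: "nat \<Rightarrow> int vec list \<Rightarrow> complex vec set" where
  "base_point N ms = proj_point (vec (Suc N) (\<lambda>i. if i < length ms then 1 else 0))"

definition X_variety :: "nat \<Rightarrow> nat \<Rightarrow> int vec list \<Rightarrow> complex vec set set" where
  "X_variety d N ms =
     zariski_closure N ((\<lambda>g. PGL_act g (base_point N ms)) ` torus_image d N ms)"

section \<open>The group \<open>M(S)\<close>\<close>

definition difference_group :: "nat \<Rightarrow> int vec set \<Rightarrow> int vec monoid" where
  "difference_group d S =
     subgroup_generated (monoid_vec TYPE(int) d) {m - m' | m m'. m \<in> S \<and> m' \<in> S}"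

end

theory Submission
  imports
    Defs
    "HOL-Combinatorics.Permutations"
begin

text \<open>
  A character \<open>M(S) \<rightarrow> \<complex>\<^sup>*\<close> extends to \<open>\<int>\<^sup>d\<close> because \<open>\<complex>\<^sup>*\<close> is divisible, and every character
  of \<open>\<int>\<^sup>d\<close> is \<open>v \<mapsto> t\<^sup>v\<close> for a point \<open>t\<close> of the torus.
  Hence \<open>\<Phi>\<close> matches the points \<open>t\<close> and \<open>u\<close> of the two tori in such a way that
  \<open>u\<^bsup>\<Phi>(v)\<^esup> = t\<^sup>v\<close> on \<open>M(S)\<close>, and each point of either torus occurs in such a pair.
  Since \<open>t\<^sup>s = t\<^sup>m t\<^bsup>s-m\<^esup>\<close> for \<open>s \<in> S\<close>, the common factor \<open>t\<^sup>m\<close> disappears projectively, so the two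
  torus orbits already agree up to the permutation of coordinates that relates the enumerations.
  A permutation of coordinates is a Zariski homeomorphism, so the closures correspond as well.
\<close>

section \<open>Extension of characters with values in a divisible group\<close>

text \<open>Finds the value \<open>c\<close> that an extension of \<open>\<chi>\<close> may take at
  \<open>g\<close>. The exponents \<open>k\<close> with \<open>g^k\<close> in \<open>H\<close> form
  a subgroup of the integers, so \<open>c\<close> has to meet at most one condition: at the least
  positive such exponent \<open>n\<close> it must be an \<open>n\<close>-th root of
  \<open>\<chi> (g^n)\<close>.\<close>

lemma ex_compatible_power:
  assumes "comm_group G" and "comm_group D"
    and div: "\<And>x n. x \<in> carrier D \<Longrightarrow> 0 < n \<Longrightarrow> \<exists>y\<in>carrier D. y [^]\<^bsub>D\<^esub> (n::nat) = x"
    and H: "subgroup H G" and \<chi>: "\<chi> \<in> hom (G\<lparr>carrier := H\<rparr>) D"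
    and g: "g \<in> carrier G"
  obtains c where "c \<in> carrier D"
    and "\<And>k::int. g [^]\<^bsub>G\<^esub> k \<in> H \<Longrightarrow> \<chi> (g [^]\<^bsub>G\<^esub> k) = c [^]\<^bsub>D\<^esub> k"
proof -
  interpret G: comm_group G by fact
  interpret D: comm_group D by fact
  interpret H: subgroup H G by fact
  have HG: "group (G\<lparr>carrier := H\<rparr>)"
    using G.subgroup_imp_group[OF H] .
  interpret \<chi>: group_hom "G\<lparr>carrier := H\<rparr>" D \<chi>
    using HG \<chi> by (simp add: group_hom_def group_hom_axioms_def D.is_group)
  have \<chi>_pow: "\<chi> (x [^]\<^bsub>G\<^esub> k) = \<chi> x [^]\<^bsub>D\<^esub> k" if "x \<in> H" for x and k :: int
    using \<chi>.hom_int_pow[of x k] G.int_pow_consistent[OF H that, of k] that by simp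
  show thesis
  proof (cases "\<exists>n>0. g [^]\<^bsub>G\<^esub> (int n) \<in> H")
    \<comment> \<open>Only \<open>k = 0\<close> qualifies here: a negative exponent could be negated
      into a positive one. Any \<open>c\<close> would then do, and the unit is taken.\<close>
    case False
    have "k = 0" if k: "g [^]\<^bsub>G\<^esub> (k::int) \<in> H" for k
    proof (rule ccontr)
      assume "k \<noteq> 0"
      have "g [^]\<^bsub>G\<^esub> (- k) \<in> H"
        using H.m_inv_closed[OF k] g by (simp add: G.int_pow_neg)
      with k have "g [^]\<^bsub>G\<^esub> \<bar>k\<bar> \<in> H"
        by (simp add: abs_if)
      with \<open>k \<noteq> 0\<close> False show False
        by (metis abs_of_nat zero_less_abs_iff nat_0_le abs_ge_zero zero_less_nat_eq)
    qed
    moreover have "\<chi> \<one>\<^bsub>G\<^esub> = \<one>\<^bsub>D\<^esub>"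
      using \<chi>.hom_one by simp
    ultimately show thesis
      by (intro that[of "\<one>\<^bsub>D\<^esub>"]) force+
  next
    case True
    define n where "n = (LEAST n. 0 < n \<and> g [^]\<^bsub>G\<^esub> (int n) \<in> H)"
    have n: "0 < n" "g [^]\<^bsub>G\<^esub> (int n) \<in> H"
      using LeastI_ex[OF True] by (auto simp: n_def)
    have least: "n \<le> j" if "0 < j" "g [^]\<^bsub>G\<^esub> (int j) \<in> H" for j
      unfolding n_def using that by (intro Least_le) auto
    \<comment> \<open>The root exists by divisibility of \<open>D\<close>.\<close>
    obtain c where c: "c \<in> carrier D" "c [^]\<^bsub>D\<^esub> (int n) = \<chi> (g [^]\<^bsub>G\<^esub> (int n))"
      using div[OF \<chi>.hom_closed \<open>0 < n\<close>, of "g [^]\<^bsub>G\<^esub> (int n)"] n by (auto simp: int_pow_int)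
    have "\<chi> (g [^]\<^bsub>G\<^esub> k) = c [^]\<^bsub>D\<^esub> k" if k: "g [^]\<^bsub>G\<^esub> k \<in> H" for k :: int
    proof -
      define q r where "q = k div int n" and "r = nat (k mod int n)"
      have kqr: "k = int n * q + int r" and "r < n"
        using \<open>0 < n\<close> by (simp_all add: q_def r_def nat_less_iff)
      have pq: "g [^]\<^bsub>G\<^esub> (int n * q) = (g [^]\<^bsub>G\<^esub> int n) [^]\<^bsub>G\<^esub> q"
        using g by (simp add: G.int_pow_pow)
      then have "g [^]\<^bsub>G\<^esub> (int n * q) \<in> H"
        using G.subgroup_int_pow_closed[OF H n(2)] by simp
      then have "g [^]\<^bsub>G\<^esub> (k - int n * q) \<in> H"
        using k g by (simp add: G.int_pow_diff H.m_inv_closed)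
      then have "g [^]\<^bsub>G\<^esub> int r \<in> H"
        by (simp add: kqr)
      \<comment> \<open>A remainder smaller than the least positive exponent must vanish, so
        \<open>k\<close> is a multiple of \<open>n\<close>.\<close>
      with least[of r] \<open>r < n\<close> have "r = 0" by fastforce
      then have "g [^]\<^bsub>G\<^esub> k = (g [^]\<^bsub>G\<^esub> int n) [^]\<^bsub>G\<^esub> q" "c [^]\<^bsub>D\<^esub> k = (c [^]\<^bsub>D\<^esub> int n) [^]\<^bsub>D\<^esub> q"
        using pq c(1) by (simp_all add: kqr D.int_pow_pow)
      then show ?thesis
        using \<chi>_pow[OF n(2)] c(2) by simp
    qed
    with c(1) show thesis by (rule that)
  qed
qed

text \<open>The extension lives on the subgroup generated by \<open>H\<close> and \<open>g\<close>
  and sends \<open>h g^k\<close> to \<open>\<chi> h c^k\<close>, with \<open>c\<close> compatible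
  with \<open>\<chi>\<close> on the powers of \<open>g\<close> lying in \<open>H\<close>.\<close>

lemma hom_extend_insert:
  assumes G: "comm_group G" and D: "comm_group D"
    and div: "\<And>x n. x \<in> carrier D \<Longrightarrow> 0 < n \<Longrightarrow> \<exists>y\<in>carrier D. y [^]\<^bsub>D\<^esub> (n::nat) = x"
    and H: "subgroup H G" and \<chi>: "\<chi> \<in> hom (G\<lparr>carrier := H\<rparr>) D"
    and g: "g \<in> carrier G"
  obtains K \<psi> where "subgroup K G" "insert g H \<subseteq> K" "\<psi> \<in> hom (G\<lparr>carrier := K\<rparr>) D"
    "\<And>h. h \<in> H \<Longrightarrow> \<psi> h = \<chi> h"
proof -
  interpret G: comm_group G by fact
  interpret D: comm_group D by fact
  interpret H: subgroup H G by fact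
  interpret \<chi>: group_hom "G\<lparr>carrier := H\<rparr>" D \<chi>
    using G.subgroup_imp_group[OF H] \<chi>
    by (simp add: group_hom_def group_hom_axioms_def D.is_group)
  have \<chi>_closed: "\<chi> h \<in> carrier D" if "h \<in> H" for h
    using \<chi>.hom_closed that by simp
  have \<chi>_mult: "\<chi> (h \<otimes>\<^bsub>G\<^esub> h') = \<chi> h \<otimes>\<^bsub>D\<^esub> \<chi> h'" if "h \<in> H" "h' \<in> H" for h h'
    using \<chi>.hom_mult that by simp
  obtain c where c: "c \<in> carrier D"
    and c_pow: "\<And>k::int. g [^]\<^bsub>G\<^esub> k \<in> H \<Longrightarrow> \<chi> (g [^]\<^bsub>G\<^esub> k) = c [^]\<^bsub>D\<^esub> k"
    using ex_compatible_power[OF G D div H \<chi> g] by blast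
  define K where "K = {h \<otimes>\<^bsub>G\<^esub> g [^]\<^bsub>G\<^esub> k | h (k::int). h \<in> H}"
  \<comment> \<open>An element may be written as \<open>h g^k\<close> in several ways;
    \<open>well_defined\<close> shows that all of them yield the same value.\<close>
  define \<psi> where "\<psi> x = (THE y. \<exists>h\<in>H. \<exists>k::int. x = h \<otimes>\<^bsub>G\<^esub> g [^]\<^bsub>G\<^esub> k \<and> y = \<chi> h \<otimes>\<^bsub>D\<^esub> c [^]\<^bsub>D\<^esub> k)" for x
  have KI: "h \<otimes>\<^bsub>G\<^esub> g [^]\<^bsub>G\<^esub> k \<in> K" if "h \<in> H" for h and k :: int
    using that by (auto simp: K_def)
  have mult_eq: "(h \<otimes>\<^bsub>G\<^esub> g [^]\<^bsub>G\<^esub> k) \<otimes>\<^bsub>G\<^esub> (h' \<otimes>\<^bsub>G\<^esub> g [^]\<^bsub>G\<^esub> k') = (h \<otimes>\<^bsub>G\<^esub> h') \<otimes>\<^bsub>G\<^esub> g [^]\<^bsub>G\<^esub> (k + k')"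
    if "h \<in> H" "h' \<in> H" for h h' and k k' :: int
    using that g by (simp add: G.int_pow_mult G.m_ac)
  have well_defined: "\<chi> h \<otimes>\<^bsub>D\<^esub> c [^]\<^bsub>D\<^esub> k = \<chi> h' \<otimes>\<^bsub>D\<^esub> c [^]\<^bsub>D\<^esub> k'"
    if h: "h \<in> H" "h' \<in> H" and eq: "h \<otimes>\<^bsub>G\<^esub> g [^]\<^bsub>G\<^esub> k = h' \<otimes>\<^bsub>G\<^esub> g [^]\<^bsub>G\<^esub> k'" for h h' and k k' :: int
  proof -
    \<comment> \<open>Two representations of one element differ by a power of \<open>g\<close> that
      lies in \<open>H\<close>, and there \<open>\<chi>\<close> agrees with the powers of
      \<open>c\<close>.\<close>
    have "h \<otimes>\<^bsub>G\<^esub> g [^]\<^bsub>G\<^esub> (k - k') = (h \<otimes>\<^bsub>G\<^esub> g [^]\<^bsub>G\<^esub> k) \<otimes>\<^bsub>G\<^esub> inv\<^bsub>G\<^esub> (g [^]\<^bsub>G\<^esub> k')"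
      using h g by (simp add: G.int_pow_diff G.m_assoc)
    also have "\<dots> = h'"
      unfolding eq using h g by (simp add: G.m_assoc)
    finally have h': "h \<otimes>\<^bsub>G\<^esub> g [^]\<^bsub>G\<^esub> (k - k') = h'" .
    then have "g [^]\<^bsub>G\<^esub> (k - k') = inv\<^bsub>G\<^esub> h \<otimes>\<^bsub>G\<^esub> h'"
      using h g by (auto simp: G.inv_solve_left)
    then have mem: "g [^]\<^bsub>G\<^esub> (k - k') \<in> H"
      using h by simp
    have "\<chi> h' = \<chi> h \<otimes>\<^bsub>D\<^esub> c [^]\<^bsub>D\<^esub> (k - k')"
      using \<chi>_mult[OF h(1) mem] c_pow[OF mem] by (simp add: h')
    then show ?thesis
      using c \<chi>_closed h by (simp add: D.int_pow_diff D.m_assoc)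
  qed
  have \<psi>: "\<psi> (h \<otimes>\<^bsub>G\<^esub> g [^]\<^bsub>G\<^esub> k) = \<chi> h \<otimes>\<^bsub>D\<^esub> c [^]\<^bsub>D\<^esub> k" if "h \<in> H" for h and k :: int
    unfolding \<psi>_def
  proof (rule the_equality)
    show "\<exists>h'\<in>H. \<exists>k'::int. h \<otimes>\<^bsub>G\<^esub> g [^]\<^bsub>G\<^esub> k = h' \<otimes>\<^bsub>G\<^esub> g [^]\<^bsub>G\<^esub> k' \<and>
        \<chi> h \<otimes>\<^bsub>D\<^esub> c [^]\<^bsub>D\<^esub> k = \<chi> h' \<otimes>\<^bsub>D\<^esub> c [^]\<^bsub>D\<^esub> k'"
      using that by blast
  qed (use that well_defined in metis)
  show thesis
  proof (rule that)
    show "subgroup K G"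
    proof (rule G.subgroupI)
      show "K \<subseteq> carrier G"
        using g by (auto simp: K_def)
      show "K \<noteq> {}"
        using KI[OF H.one_closed] by blast
    next
      fix x assume "x \<in> K"
      then obtain h k where x: "h \<in> H" "x = h \<otimes>\<^bsub>G\<^esub> g [^]\<^bsub>G\<^esub> (k::int)"
        by (auto simp: K_def)
      then have "inv\<^bsub>G\<^esub> x = inv\<^bsub>G\<^esub> h \<otimes>\<^bsub>G\<^esub> g [^]\<^bsub>G\<^esub> (- k)"
        using g by (simp add: G.inv_mult G.int_pow_neg)
      then show "inv\<^bsub>G\<^esub> x \<in> K"
        using x KI by simp
    next
      fix x y assume "x \<in> K" "y \<in> K"
      then show "x \<otimes>\<^bsub>G\<^esub> y \<in> K"
        unfolding K_def using mult_eq H.m_closed by blast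
    qed
    have "g \<in> K"
      using KI[OF H.one_closed, of 1] g by simp
    moreover have "H \<subseteq> K"
      using KI[of _ 0] by fastforce
    ultimately show "insert g H \<subseteq> K" by simp
    show "\<psi> h = \<chi> h" if "h \<in> H" for h
      using \<psi>[OF that, of 0] \<chi>_closed[OF that] that by simp
    show "\<psi> \<in> hom (G\<lparr>carrier := K\<rparr>) D"
    proof (rule homI; simp)
      fix x assume "x \<in> K"
      then show "\<psi> x \<in> carrier D"
        using \<psi> \<chi>_closed c by (auto simp: K_def)
    next
      fix x y assume "x \<in> K" "y \<in> K"
      then obtain h k h' k' where "h \<in> H" "x = h \<otimes>\<^bsub>G\<^esub> g [^]\<^bsub>G\<^esub> (k::int)" "h' \<in> H" "y = h' \<otimes>\<^bsub>G\<^esub> g [^]\<^bsub>G\<^esub> (k'::int)"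
        by (auto simp: K_def)
      then show "\<psi> (x \<otimes>\<^bsub>G\<^esub> y) = \<psi> x \<otimes>\<^bsub>D\<^esub> \<psi> y"
        using c \<chi>_closed by (simp add: mult_eq \<psi> \<chi>_mult D.int_pow_mult D.m_ac)
    qed
  qed
qed

text \<open>The generators are adjoined one at a time, so finite induction takes the place of Zorn's
  lemma.\<close>

lemma hom_extend_finitely_generated:
  assumes G: "comm_group G" and D: "comm_group D"
    and div: "\<And>x n. x \<in> carrier D \<Longrightarrow> 0 < n \<Longrightarrow> \<exists>y\<in>carrier D. y [^]\<^bsub>D\<^esub> (n::nat) = x"
    and H: "subgroup H G" and \<chi>: "\<chi> \<in> hom (G\<lparr>carrier := H\<rparr>) D"
    and A: "finite A" "generate G A = carrier G"
  obtains \<psi> where "\<psi> \<in> hom G D" "\<And>h. h \<in> H \<Longrightarrow> \<psi> h = \<chi> h"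
proof -
  interpret G: comm_group G by fact
  have "A \<subseteq> carrier G"
    using A(2) generate.incl[of _ A G] by auto
  with A(1) have "\<exists>K \<psi>. subgroup K G \<and> A \<union> H \<subseteq> K \<and> \<psi> \<in> hom (G\<lparr>carrier := K\<rparr>) D \<and> (\<forall>h\<in>H. \<psi> h = \<chi> h)"
  proof (induction A rule: finite_induct)
    case empty
    then show ?case using H \<chi> by auto
  next
    case (insert a A)
    then obtain K \<psi> where K: "subgroup K G" "A \<union> H \<subseteq> K" "\<psi> \<in> hom (G\<lparr>carrier := K\<rparr>) D"
      "\<forall>h\<in>H. \<psi> h = \<chi> h" "a \<in> carrier G"
      by auto
    obtain K' \<psi>' where "subgroup K' G" "insert a K \<subseteq> K'" "\<psi>' \<in> hom (G\<lparr>carrier := K'\<rparr>) D"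
      "\<And>h. h \<in> K \<Longrightarrow> \<psi>' h = \<psi> h"
      using hom_extend_insert[OF G D div K(1,3,5)] by blast
    with K show ?case
      by (intro exI[of _ K'] exI[of _ \<psi>']) auto
  qed
  then obtain K \<psi> where K: "subgroup K G" "A \<subseteq> K" "\<psi> \<in> hom (G\<lparr>carrier := K\<rparr>) D" "\<forall>h\<in>H. \<psi> h = \<chi> h"
    by auto
  have "carrier G \<subseteq> K"
    using G.generate_subgroup_incl[OF K(2,1)] A(2) by simp
  then have "K = carrier G"
    using subgroup.subset[OF K(1)] by blast
  with K(3,4) show thesis
    by (intro that[of \<psi>]) auto
qed

section \<open>Characters of the integer lattice as points of the torus\<close>

definition nonzero_complex :: "complex monoid" where
  "nonzero_complex = \<lparr>carrier = - {0}, mult = (*), one = 1\<rparr>"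

lemma nonzero_complex_simps [simp]:
  "carrier nonzero_complex = - {0}"
  "x \<otimes>\<^bsub>nonzero_complex\<^esub> y = x * y"
  "\<one>\<^bsub>nonzero_complex\<^esub> = 1"
  by (simp_all add: nonzero_complex_def)

lemma comm_group_nonzero_complex: "comm_group nonzero_complex"
proof (rule comm_groupI)
  fix x assume "x \<in> carrier nonzero_complex"
  then show "\<exists>y\<in>carrier nonzero_complex. y \<otimes>\<^bsub>nonzero_complex\<^esub> x = \<one>\<^bsub>nonzero_complex\<^esub>"
    by (intro bexI[of _ "inverse x"]) simp_all
qed (simp_all add: ac_simps)

lemma nat_pow_nonzero_complex [simp]: "x [^]\<^bsub>nonzero_complex\<^esub> (n::nat) = x ^ n"
  by (induction n) (simp_all add: nat_pow_def)

text \<open>A nonzero number has exactly \<open>n\<close> distinct \<open>n\<close>-th roots, hence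
  at least one, and a root of a nonzero number is nonzero.\<close>

lemma nonzero_complex_divisible:
  assumes "x \<in> carrier nonzero_complex" and "0 < n"
  shows "\<exists>y\<in>carrier nonzero_complex. y [^]\<^bsub>nonzero_complex\<^esub> (n::nat) = x"
proof -
  have "card {y. y ^ n = x} = n"
    using assms by (intro card_nth_roots) auto
  then have "{y. y ^ n = x} \<noteq> {}"
    using assms(2) by (metis card.empty less_irrefl)
  then obtain y where "y ^ n = x" by blast
  then show ?thesis
    using assms by (intro bexI[of _ y]) (auto simp: power_0_left)
qed

lemma generate_unit_vecs: "generate (monoid_vec TYPE(int) d) (unit_vec d ` {..<d}) = carrier_vec d"
  (is "?M = _")
proof -
  let ?G = "monoid_vec TYPE(int) d"
  interpret G: comm_group ?G by (rule comm_group_vec)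
  have M: "subgroup ?M ?G"
    by (rule G.generate_is_subgroup) (auto simp: monoid_vec_simps)
  have add: "x + y \<in> ?M" if "x \<in> ?M" "y \<in> ?M" for x y
    using subgroup.m_closed[OF M that] by (simp add: monoid_vec_simps)
  have unit: "unit_vec d k \<in> ?M" if "k < d" for k
    using that by (auto intro: generate.incl)
  have uminus: "- x \<in> ?M" if "x \<in> ?M" for x
  proof -
    have x: "x \<in> carrier_vec d"
      using subgroup.mem_carrier[OF M that] by (simp add: monoid_vec_simps)
    have "inv\<^bsub>?G\<^esub> x = - x"
      by (rule G.inv_equality) (use x in \<open>simp_all add: monoid_vec_simps\<close>)
    then show ?thesis
      using subgroup.m_inv_closed[OF M that] by simp
  qed
  \<comment> \<open>The induction runs from 0 in both directions; the downward step uses closure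
    under negation.\<close>
  have multiple: "a \<cdot>\<^sub>v unit_vec d k \<in> ?M" if "k < d" for k and a :: int
  proof (induction a rule: int_induct[of _ 0])
    case base
    have "0 \<cdot>\<^sub>v unit_vec d k = (0\<^sub>v d :: int vec)" by auto
    then show ?case
      using subgroup.one_closed[OF M] by (simp add: monoid_vec_simps)
  next
    case (step1 i)
    then show ?case
      using add[OF step1(2) unit[OF that]] by (simp add: add_smult_distrib_vec)
  next
    case (step2 i)
    have "(i - 1) \<cdot>\<^sub>v unit_vec d k = i \<cdot>\<^sub>v unit_vec d k + - unit_vec d k"
      by (intro eq_vecI) (auto simp: algebra_simps)
    then show ?case
      using add[OF step2(2) uminus[OF unit[OF that]]] by simp
  qed
  have "v \<in> ?M" if v: "v \<in> carrier_vec d" for v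
  proof -
    \<comment> \<open>The vector is assembled one coordinate at a time; the truncation at
      \<open>k = d\<close> is \<open>v\<close> itself.\<close>
    have "vec d (\<lambda>i. if i < k then v $ i else 0) \<in> ?M" if "k \<le> d" for k
      using that
    proof (induction k)
      case 0
      have "vec d (\<lambda>i. if i < 0 then v $ i else 0) = 0\<^sub>v d" by auto
      then show ?case
        using subgroup.one_closed[OF M] by (simp add: monoid_vec_simps)
    next
      case (Suc k)
      have "vec d (\<lambda>i. if i < Suc k then v $ i else 0) =
          vec d (\<lambda>i. if i < k then v $ i else 0) + v $ k \<cdot>\<^sub>v unit_vec d k"
        using Suc.prems by (intro eq_vecI) (auto simp: less_Suc_eq)
      then show ?case
        using add[OF Suc.IH multiple, of k "v $ k"] Suc.prems by simp
    qed
    moreover have "vec d (\<lambda>i. if i < d then v $ i else 0) = v"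
      using v by (intro eq_vecI) auto
    ultimately show ?thesis
      by (metis order_refl)
  qed
  moreover have "?M \<subseteq> carrier_vec d"
    using subgroup.subset[OF M] by (simp add: monoid_vec_simps)
  ultimately show ?thesis by blast
qed

text \<open>Integer powers turn sums of exponents into products because the coordinates of
  \<open>t\<close> are nonzero.\<close>

lemma torus_monom_hom:
  assumes "t \<in> carrier (torus d)"
  shows "torus_monom d t \<in> hom (monoid_vec TYPE(int) d) nonzero_complex"
  using assms
  by (intro homI) (auto simp: torus_monom_def torus_def monoid_vec_simps power_int_add prod.distrib)

lemma torus_monom_unit_vec:
  assumes "k < d"
  shows "torus_monom d t (unit_vec d k) = t $ k"
proof -
  have "torus_monom d t (unit_vec d k) = (\<Prod>i<d. if i = k then t $ i else 1)"
    unfolding torus_monom_def by (intro prod.cong) (auto simp: unit_vec_def)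
  then show ?thesis using assms by simp
qed

text \<open>Two characters that agree on the unit vectors agree everywhere, so \<open>t\<close> is
  forced to have the values of \<open>\<chi>\<close> at the unit vectors as coordinates.\<close>

lemma ex_torus_monom_eq:
  assumes \<chi>: "\<chi> \<in> hom (monoid_vec TYPE(int) d) nonzero_complex"
  obtains t where "t \<in> carrier (torus d)" "\<And>v. v \<in> carrier_vec d \<Longrightarrow> torus_monom d t v = \<chi> v"
proof -
  let ?G = "monoid_vec TYPE(int) d"
  interpret G: comm_group ?G by (rule comm_group_vec)
  interpret C: comm_group nonzero_complex by (rule comm_group_nonzero_complex)
  define t where "t = vec d (\<lambda>i. \<chi> (unit_vec d i))"
  interpret \<chi>: group_hom ?G nonzero_complex \<chi>
    using \<chi> by (simp add: group_hom_def group_hom_axioms_def)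
  have t: "t \<in> carrier (torus d)"
    using \<chi>.hom_closed by (auto simp: t_def torus_def monoid_vec_simps)
  interpret t: group_hom ?G nonzero_complex "torus_monom d t"
    using torus_monom_hom[OF t] by (simp add: group_hom_def group_hom_axioms_def)
  \<comment> \<open>Membership in the carrier is carried through the induction so that the
    homomorphism laws apply.\<close>
  have "v \<in> carrier ?G \<and> torus_monom d t v = \<chi> v" if "v \<in> generate ?G (unit_vec d ` {..<d})" for v
    using that
  proof induction
    case (incl h)
    then show ?case by (auto simp: torus_monom_unit_vec t_def monoid_vec_simps)
  next
    case (inv h)
    then have "h \<in> carrier ?G" "torus_monom d t h = \<chi> h"
      by (auto simp: torus_monom_unit_vec t_def monoid_vec_simps)
    then show ?case by simp
  qed simp_all
  then show thesis
    by (intro that[OF t]) (simp add: generate_unit_vecs)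
qed

section \<open>Coordinate permutations acting on projective space\<close>

text \<open>The 1 of row \<open>i\<close> stands in column \<open>\<sigma> i\<close>, so the matrix
  pulls a coordinate vector back along \<open>\<sigma>\<close>. Products therefore compose the
  permutations in reverse order.\<close>

definition reindex_mat :: "nat \<Rightarrow> (nat \<Rightarrow> nat) \<Rightarrow> complex mat" where
  "reindex_mat n \<sigma> = mat n n (\<lambda>(i, j). if j = \<sigma> i then 1 else 0)"

lemma reindex_mat_carrier [simp]: "reindex_mat n \<sigma> \<in> carrier_mat n n"
  by (simp add: reindex_mat_def)

lemma reindex_mat_mult_vec:
  assumes "v \<in> carrier_vec n" and "\<sigma> permutes {..<n}"
  shows "reindex_mat n \<sigma> *\<^sub>v v = vec n (\<lambda>i. v $ \<sigma> i)"
proof (intro eq_vecI)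
  fix i assume "i < dim_vec (vec n (\<lambda>i. v $ \<sigma> i))"
  then have i: "i < n" "\<sigma> i < n"
    using permutes_in_image[OF assms(2), of i] by auto
  have "(reindex_mat n \<sigma> *\<^sub>v v) $ i = (\<Sum>j = 0..<n. (if j = \<sigma> i then 1 else 0) * v $ j)"
    using assms(1) i by (auto simp: reindex_mat_def scalar_prod_def intro!: sum.cong)
  also have "\<dots> = (\<Sum>j = 0..<n. if j = \<sigma> i then v $ j else 0)"
    by (intro sum.cong) auto
  finally show "(reindex_mat n \<sigma> *\<^sub>v v) $ i = vec n (\<lambda>i. v $ \<sigma> i) $ i"
    using i by simp
qed (simp add: reindex_mat_def)

lemma reindex_mat_mult:
  assumes "\<sigma> permutes {..<n}"
  shows "reindex_mat n \<sigma> * reindex_mat n \<tau> = reindex_mat n (\<tau> \<circ> \<sigma>)"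
proof (intro eq_matI)
  fix i j assume "i < dim_row (reindex_mat n (\<tau> \<circ> \<sigma>))" "j < dim_col (reindex_mat n (\<tau> \<circ> \<sigma>))"
  then have ij: "i < n" "j < n" "\<sigma> i < n"
    using permutes_in_image[OF assms, of i] by (auto simp: reindex_mat_def)
  have "(reindex_mat n \<sigma> * reindex_mat n \<tau>) $$ (i, j) =
      (\<Sum>k = 0..<n. (if k = \<sigma> i then 1 else 0) * (if j = \<tau> k then 1 else 0))"
    using ij by (auto simp: reindex_mat_def scalar_prod_def intro!: sum.cong)
  also have "\<dots> = (\<Sum>k = 0..<n. if k = \<sigma> i then if j = \<tau> k then 1 else 0 else 0)"
    by (intro sum.cong) auto
  finally show "(reindex_mat n \<sigma> * reindex_mat n \<tau>) $$ (i, j) = reindex_mat n (\<tau> \<circ> \<sigma>) $$ (i, j)"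
    using ij by (simp add: reindex_mat_def)
qed (simp_all add: reindex_mat_def)

lemma reindex_mat_id: "reindex_mat n id = 1\<^sub>m n"
  by (intro eq_matI) (auto simp: reindex_mat_def)

lemma PGL_class_reindex_mat:
  assumes "\<sigma> permutes {..<n}"
  shows "PGL_class n (reindex_mat n \<sigma>) \<in> carrier (PGL n)"
proof -
  have "reindex_mat n \<sigma> \<in> carrier (GL n)"
    unfolding GL_carrier
    using reindex_mat_mult[OF assms, of "inv_into UNIV \<sigma>"] reindex_mat_mult[OF permutes_inv[OF assms], of \<sigma>]
    by (auto simp: permutes_inv_o[OF assms] reindex_mat_id intro!: bexI[of _ "reindex_mat n (inv_into UNIV \<sigma>)"])
  then show ?thesis
    by (auto simp: PGL_def FactGroup_def RCOSETS_def PGL_class_def)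
qed

definition reindex :: "nat \<Rightarrow> (nat \<Rightarrow> nat) \<Rightarrow> complex vec set \<Rightarrow> complex vec set" where
  "reindex n \<sigma> = PGL_act (PGL_class n (reindex_mat n \<sigma>))"

lemma reindex_proj_point:
  assumes "v \<in> carrier_vec n" and "\<sigma> permutes {..<n}"
  shows "reindex n \<sigma> (proj_point v) = proj_point (vec n (\<lambda>i. v $ \<sigma> i))"
  using assms by (simp add: reindex_def PGL_act_class reindex_mat_mult_vec)

lemma reindex_reindex:
  assumes p: "p \<in> proj_space N" and \<sigma>: "\<sigma> permutes {..<Suc N}" and \<tau>: "\<tau> permutes {..<Suc N}"
    and "\<sigma> \<circ> \<tau> = id"
  shows "reindex (Suc N) \<tau> (reindex (Suc N) \<sigma> p) = p"
proof -
  obtain v where v: "v \<in> carrier_vec (Suc N)" "p = proj_point v"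
    using p by (auto simp: proj_space_def)
  have "vec (Suc N) (\<lambda>i. vec (Suc N) (\<lambda>i. v $ \<sigma> i) $ \<tau> i) = v"
    using v(1) permutes_in_image[OF \<tau>] assms(4) by (intro eq_vecI) (auto simp: fun_eq_iff)
  then show ?thesis
    using v \<sigma> \<tau> by (simp add: reindex_proj_point)
qed

lemma reindex_in_proj_space:
  assumes p: "p \<in> proj_space N" and \<sigma>: "\<sigma> permutes {..<Suc N}"
  shows "reindex (Suc N) \<sigma> p \<in> proj_space N"
proof -
  obtain v where v: "v \<in> carrier_vec (Suc N)" "v \<noteq> 0\<^sub>v (Suc N)" "p = proj_point v"
    using p by (auto simp: proj_space_def)
  have "vec (Suc N) (\<lambda>i. v $ \<sigma> i) \<noteq> 0\<^sub>v (Suc N)"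
  proof
    assume eq: "vec (Suc N) (\<lambda>i. v $ \<sigma> i) = 0\<^sub>v (Suc N)"
    \<comment> \<open>Coordinate \<open>i\<close> of \<open>v\<close> reappears at the position that
      \<open>\<sigma>\<close> maps to \<open>i\<close>.\<close>
    have "v $ i = 0" if "i < Suc N" for i
    proof -
      have "inv_into UNIV \<sigma> i < Suc N"
        using permutes_in_image[OF permutes_inv[OF \<sigma>], of i] that by simp
      from arg_cong[OF eq, of "\<lambda>w. w $ inv_into UNIV \<sigma> i"] this show ?thesis
        by (simp add: permutes_inverses[OF \<sigma>])
    qed
    then have "v = 0\<^sub>v (Suc N)"
      using v(1) by (intro eq_vecI) auto
    with v(2) show False by contradiction
  qed
  then show ?thesis
    using v \<sigma> by (auto simp: reindex_proj_point proj_space_def)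
qed

section \<open>Permuted polynomials and Zariski closures\<close>

text \<open>This substitutes the variable with index \<open>\<sigma> i\<close> for the one with
  index \<open>i\<close>: the coefficient at an exponent vector \<open>a\<close> is that of
  \<open>f\<close> at the composite of \<open>a\<close> with \<open>\<sigma>\<close>.\<close>

definition reindex_poly :: "(nat \<Rightarrow> nat) \<Rightarrow> cpoly \<Rightarrow> cpoly" where
  "reindex_poly \<sigma> f = Poly_Mapping.map_key (Poly_Mapping.map_key \<sigma>) f"

text \<open>The outer \<open>map_key\<close> in \<open>reindex_poly\<close> acts as composition once
  the inner one is known to be injective.\<close>

lemma bij_map_key:
  assumes "bij \<sigma>"
  shows "bij (Poly_Mapping.map_key \<sigma>)"
proof (rule o_bij)
  note inj = bij_is_inj[OF assms] bij_is_inj[OF bij_imp_bij_inv[OF assms]]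
  have comp: "\<sigma> \<circ> inv_into UNIV \<sigma> = (\<lambda>x. x)" "inv_into UNIV \<sigma> \<circ> \<sigma> = (\<lambda>x. x)"
    using assms by (simp_all add: fun_eq_iff surj_f_inv_f inv_f_f bij_is_surj bij_is_inj)
  then show "Poly_Mapping.map_key (inv_into UNIV \<sigma>) \<circ> Poly_Mapping.map_key \<sigma> = id"
    "Poly_Mapping.map_key \<sigma> \<circ> Poly_Mapping.map_key (inv_into UNIV \<sigma>) = id"
    by (simp_all add: fun_eq_iff inj map_key_compose comp map_key_id)
qed

text \<open>Oriented so that a sum over the keys of \<open>f\<close> can be rewritten as a sum over
  those of the permuted polynomial.\<close>

lemma keys_reindex_poly:
  assumes "bij \<sigma>"
  shows "Poly_Mapping.keys f = Poly_Mapping.map_key \<sigma> ` Poly_Mapping.keys (reindex_poly \<sigma> f)"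
  unfolding reindex_poly_def keys_map_key[OF bij_is_inj[OF bij_map_key[OF assms]]]
  by (rule surj_image_vimage_eq[OF bij_is_surj[OF bij_map_key[OF assms]], symmetric])

lemma keys_map_key_bij:
  assumes "bij \<sigma>"
  shows "Poly_Mapping.keys a = \<sigma> ` Poly_Mapping.keys (Poly_Mapping.map_key \<sigma> a)"
  using assms by (simp add: keys_map_key bij_is_inj bij_is_surj surj_image_vimage_eq)

text \<open>Exponents are only moved between variables, which preserves the degree, and
  \<open>\<sigma>\<close> keeps the indices up to \<open>N\<close> among themselves.\<close>

lemma homogeneous_reindex_poly:
  assumes f: "homogeneous_poly N f" and \<sigma>: "\<sigma> permutes {..<Suc N}"
  shows "homogeneous_poly N (reindex_poly \<sigma> f)"
proof -
  have bij: "bij \<sigma>" using \<sigma> by (rule permutes_bij)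
  obtain k where k: "\<And>a. a \<in> Poly_Mapping.keys f \<Longrightarrow>
      (\<Sum>i\<in>Poly_Mapping.keys a. Poly_Mapping.lookup a i) = k"
    and vars: "\<And>a. a \<in> Poly_Mapping.keys f \<Longrightarrow> Poly_Mapping.keys a \<subseteq> {..N}"
    using f by (auto simp: homogeneous_poly_def)
  have "Poly_Mapping.keys a \<subseteq> {..N} \<and> (\<Sum>i\<in>Poly_Mapping.keys a. Poly_Mapping.lookup a i) = k"
    if a: "a \<in> Poly_Mapping.keys (reindex_poly \<sigma> f)" for a
  proof -
    let ?b = "Poly_Mapping.map_key \<sigma> a"
    have b: "?b \<in> Poly_Mapping.keys f"
      using a keys_reindex_poly[OF bij, of f] by blast
    have "(\<Sum>i\<in>Poly_Mapping.keys a. Poly_Mapping.lookup a i)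
        = (\<Sum>i\<in>Poly_Mapping.keys ?b. Poly_Mapping.lookup a (\<sigma> i))"
      unfolding keys_map_key_bij[OF bij, of a]
      by (subst sum.reindex) (auto intro: inj_on_subset[OF bij_is_inj[OF bij]])
    also have "\<dots> = k"
      using k[OF b] by (simp add: map_key.rep_eq bij_is_inj[OF bij])
    finally show ?thesis
      using vars[OF b] permutes_in_image[OF \<sigma>] keys_map_key_bij[OF bij, of a]
      by (auto simp: less_Suc_eq_le)
  qed
  then show ?thesis by (auto simp: homogeneous_poly_def)
qed

lemma poly_value_reindex_poly:
  assumes f: "homogeneous_poly N f" and \<sigma>: "\<sigma> permutes {..<Suc N}"
  shows "poly_value (reindex_poly \<sigma> f) v = poly_value f (vec (Suc N) (\<lambda>i. v $ \<sigma> i))"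
proof -
  have bij: "bij \<sigma>" using \<sigma> by (rule permutes_bij)
  let ?w = "vec (Suc N) (\<lambda>i. v $ \<sigma> i)"
  have mon: "(\<Prod>i\<in>Poly_Mapping.keys a. v $ i ^ Poly_Mapping.lookup a i) =
      (\<Prod>i\<in>Poly_Mapping.keys (Poly_Mapping.map_key \<sigma> a). ?w $ i ^ Poly_Mapping.lookup (Poly_Mapping.map_key \<sigma> a) i)"
    if a: "a \<in> Poly_Mapping.keys (reindex_poly \<sigma> f)" for a
  proof -
    let ?b = "Poly_Mapping.map_key \<sigma> a"
    have "?b \<in> Poly_Mapping.keys f"
      using a keys_reindex_poly[OF bij, of f] by blast
    then have b: "Poly_Mapping.keys ?b \<subseteq> {..N}"
      using f by (auto simp: homogeneous_poly_def)
    have "(\<Prod>i\<in>Poly_Mapping.keys a. v $ i ^ Poly_Mapping.lookup a i) =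
        (\<Prod>i\<in>Poly_Mapping.keys ?b. v $ \<sigma> i ^ Poly_Mapping.lookup a (\<sigma> i))"
      unfolding keys_map_key_bij[OF bij, of a]
      by (subst prod.reindex) (auto intro: inj_on_subset[OF bij_is_inj[OF bij]])
    \<comment> \<open>The variable bound from homogeneity keeps every index inside the range of the
      vector \<open>?w\<close>.\<close>
    also have "\<dots> = (\<Prod>i\<in>Poly_Mapping.keys ?b. ?w $ i ^ Poly_Mapping.lookup ?b i)"
      using b by (intro prod.cong) (auto simp: map_key.rep_eq bij_is_inj[OF bij])
    finally show ?thesis .
  qed
  show ?thesis
    unfolding poly_value_def keys_reindex_poly[OF bij, of f]
    by (subst sum.reindex)
       (auto intro!: sum.cong inj_on_subset[OF bij_is_inj[OF bij_map_key[OF bij]]]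
         simp: mon reindex_poly_def map_key.rep_eq bij_is_inj[OF bij_map_key[OF bij]])
qed

lemma zariski_closure_subset_proj_space:
  assumes "A \<subseteq> proj_space N"
  shows "zariski_closure N A \<subseteq> proj_space N"
proof -
  \<comment> \<open>The whole space is cut out by the empty family of equations.\<close>
  have "zariski_closed N (proj_space N)"
    unfolding zariski_closed_def by (intro exI[of _ "{}"]) auto
  with assms show ?thesis
    unfolding zariski_closure_def by (rule hull_minimal)
qed

text \<open>Continuity of the coordinate permutation: the preimage is cut out by the permuted
  equations.\<close>

lemma zariski_closed_reindex_vimage:
  assumes Z: "zariski_closed N Z" and \<sigma>: "\<sigma> permutes {..<Suc N}"
  shows "zariski_closed N {p \<in> proj_space N. reindex (Suc N) \<sigma> p \<in> Z}"
proof -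
  obtain F where F: "\<And>f. f \<in> F \<Longrightarrow> homogeneous_poly N f"
    and Z_eq: "Z = {p \<in> proj_space N. \<forall>f \<in> F. \<forall>v \<in> p. poly_value f v = 0}"
    using Z by (auto simp: zariski_closed_def)
  have "reindex (Suc N) \<sigma> p \<in> Z \<longleftrightarrow> (\<forall>f \<in> reindex_poly \<sigma> ` F. \<forall>v \<in> p. poly_value f v = 0)"
    if p: "p \<in> proj_space N" for p
  proof -
    obtain v where v: "v \<in> carrier_vec (Suc N)" "p = proj_point v"
      using p by (auto simp: proj_space_def)
    \<comment> \<open>Closedness quantifies over all representatives of a point, so the action has
      to be described on the full set of them.\<close>
    have "reindex (Suc N) \<sigma> p = (\<lambda>v. vec (Suc N) (\<lambda>i. v $ \<sigma> i)) ` p"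
    proof -
      have "c \<cdot>\<^sub>v vec (Suc N) (\<lambda>i. v $ \<sigma> i) = vec (Suc N) (\<lambda>i. (c \<cdot>\<^sub>v v) $ \<sigma> i)" for c
        using v(1) permutes_in_image[OF \<sigma>] by (intro eq_vecI) auto
      then show ?thesis
        unfolding v(2) reindex_proj_point[OF v(1) \<sigma>] by (auto simp: proj_point_def)
    qed
    then show ?thesis
      using F reindex_in_proj_space[OF p \<sigma>] by (auto simp: Z_eq poly_value_reindex_poly[OF _ \<sigma>])
  qed
  then show ?thesis
    unfolding zariski_closed_def
    using F by (intro exI[of _ "reindex_poly \<sigma> ` F"]) (auto intro: homogeneous_reindex_poly[OF _ \<sigma>])
qed

text \<open>The preimage of any closed set containing the image of \<open>A\<close> is closed and
  contains \<open>A\<close>, hence also its closure.\<close>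

lemma reindex_zariski_closure_subset:
  assumes A: "A \<subseteq> proj_space N" and \<sigma>: "\<sigma> permutes {..<Suc N}"
  shows "reindex (Suc N) \<sigma> ` zariski_closure N A \<subseteq> zariski_closure N (reindex (Suc N) \<sigma> ` A)"
proof -
  have "reindex (Suc N) \<sigma> p \<in> Z"
    if p: "p \<in> zariski_closure N A" and Z: "zariski_closed N Z" "reindex (Suc N) \<sigma> ` A \<subseteq> Z" for p Z
  proof -
    have "zariski_closure N A \<subseteq> {p \<in> proj_space N. reindex (Suc N) \<sigma> p \<in> Z}"
      unfolding zariski_closure_def using A Z \<sigma>
      by (intro hull_minimal zariski_closed_reindex_vimage) auto
    with p show ?thesis by blast
  qed
  then show ?thesis
    by (auto simp: zariski_closure_def hull_def)
qed

lemma reindex_zariski_closure: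
  assumes A: "A \<subseteq> proj_space N" and \<sigma>: "\<sigma> permutes {..<Suc N}"
  shows "reindex (Suc N) \<sigma> ` zariski_closure N A = zariski_closure N (reindex (Suc N) \<sigma> ` A)"
proof
  let ?g = "reindex (Suc N) \<sigma>" and ?h = "reindex (Suc N) (inv_into UNIV \<sigma>)"
  have \<sigma>': "inv_into UNIV \<sigma> permutes {..<Suc N}"
    using \<sigma> by (rule permutes_inv)
  have hg: "?h (?g p) = p" if "p \<in> proj_space N" for p
    using reindex_reindex[OF that \<sigma> \<sigma>'] permutes_inv_o[OF \<sigma>] by simp
  have gh: "?g (?h p) = p" if "p \<in> proj_space N" for p
    using reindex_reindex[OF that \<sigma>' \<sigma>] permutes_inv_o[OF \<sigma>] by simp
  have gA: "?g ` A \<subseteq> proj_space N"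
    using A reindex_in_proj_space[OF _ \<sigma>] by blast
  \<comment> \<open>The reverse inclusion is the same continuity statement for the inverse
    permutation, applied to the image of \<open>A\<close>.\<close>
  have "?h ` zariski_closure N (?g ` A) \<subseteq> zariski_closure N (?h ` ?g ` A)"
    using gA \<sigma>' by (rule reindex_zariski_closure_subset)
  also have "?h ` ?g ` A = A"
    using A hg by force
  finally have "?g ` ?h ` zariski_closure N (?g ` A) \<subseteq> ?g ` zariski_closure N A"
    by blast
  moreover have "?g ` ?h ` zariski_closure N (?g ` A) = zariski_closure N (?g ` A)"
    using zariski_closure_subset_proj_space[OF gA] gh by force
  ultimately show "zariski_closure N (?g ` A) \<subseteq> ?g ` zariski_closure N A" by simp
qed (rule reindex_zariski_closure_subset[OF A \<sigma>])

section \<open>Torus orbits in homogeneous coordinates\<close>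

lemma proj_point_smult:
  assumes "c \<noteq> 0"
  shows "proj_point (c \<cdot>\<^sub>v v) = proj_point v"
proof (intro equalityI subsetI)
  fix w assume "w \<in> proj_point (c \<cdot>\<^sub>v v)"
  then obtain k where "k \<noteq> 0" "w = (k * c) \<cdot>\<^sub>v v"
    by (auto simp: proj_point_def smult_smult_assoc)
  with assms show "w \<in> proj_point v"
    unfolding proj_point_def by (intro CollectI exI[of _ "k * c"]) simp
next
  fix w assume "w \<in> proj_point v"
  then obtain k where "k \<noteq> 0" "w = k \<cdot>\<^sub>v v"
    by (auto simp: proj_point_def)
  with assms show "w \<in> proj_point (c \<cdot>\<^sub>v v)"
    unfolding proj_point_def by (intro CollectI exI[of _ "k / c"]) (simp add: smult_smult_assoc)
qed

lemma torus_monom_nonzero: "t \<in> carrier (torus d) \<Longrightarrow> torus_monom d t v \<noteq> 0"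
  by (auto simp: torus_monom_def torus_def)

text \<open>The translate of the base point by \<open>t\<close>. The padding is 0 although the
  diagonal matrix is padded with ones, because those ones meet the zeros of the base point.\<close>

definition orbit_point :: "nat \<Rightarrow> nat \<Rightarrow> int vec list \<Rightarrow> complex vec \<Rightarrow> complex vec set" where
  "orbit_point d N ms t =
     proj_point (vec (Suc N) (\<lambda>i. if i < length ms then torus_monom d t (ms ! i) else 0))"

lemma PGL_act_torus_to_PGL_base_point:
  "PGL_act (torus_to_PGL d N ms t) (base_point N ms) = orbit_point d N ms t"
proof -
  let ?f = "\<lambda>i. if i < length ms then torus_monom d t (ms ! i) else 1"
  let ?v = "vec (Suc N) (\<lambda>i. if i < length ms then 1 else 0) :: complex vec"
  have "mat_diag (Suc N) ?f *\<^sub>v ?v =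
      vec (Suc N) (\<lambda>i. if i < length ms then torus_monom d t (ms ! i) else 0)"
  proof (intro eq_vecI)
    fix i assume "i < dim_vec (vec (Suc N) (\<lambda>i. if i < length ms then torus_monom d t (ms ! i) else 0))"
    then have i: "i < Suc N" by simp
    have "(mat_diag (Suc N) ?f *\<^sub>v ?v) $ i = (\<Sum>j = 0..<Suc N. (if i = j then ?f j else 0) * ?v $ j)"
      using i unfolding mat_diag_def mult_mat_vec_def scalar_prod_def
      by (auto intro!: sum.cong)
    also have "\<dots> = (\<Sum>j = 0..<Suc N. if j = i then ?f i * ?v $ i else 0)"
      by (intro sum.cong) auto
    also have "\<dots> = ?f i * ?v $ i"
      using i by (subst sum.delta) auto
    finally show "(mat_diag (Suc N) ?f *\<^sub>v ?v) $ i =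
        vec (Suc N) (\<lambda>i. if i < length ms then torus_monom d t (ms ! i) else 0) $ i"
      using i by simp
  qed (simp add: mat_diag_def)
  then show ?thesis
    unfolding torus_to_PGL_def base_point_def orbit_point_def
    by (subst PGL_act_class) simp_all
qed

lemma X_variety_eq:
  "X_variety d N ms = zariski_closure N (orbit_point d N ms ` carrier (torus d))"
  by (simp add: X_variety_def torus_image_def image_image PGL_act_torus_to_PGL_base_point)

lemma orbit_point_in_proj_space:
  assumes "t \<in> carrier (torus d)" and "ms \<noteq> []"
  shows "orbit_point d N ms t \<in> proj_space N"
proof -
  have "vec (Suc N) (\<lambda>i. if i < length ms then torus_monom d t (ms ! i) else 0) \<noteq> 0\<^sub>v (Suc N)"
    (is "?v \<noteq> _")
  proof
    assume "?v = 0\<^sub>v (Suc N)"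
    \<comment> \<open>Coordinate 0 is a monomial value, as the list is non-empty, and monomials do
      not vanish on the torus.\<close>
    then have "?v $ 0 = 0\<^sub>v (Suc N) $ 0" by simp
    then show False
      using torus_monom_nonzero[OF assms(1)] assms(2) by simp
  qed
  then show ?thesis
    by (auto simp: orbit_point_def proj_space_def)
qed

section \<open>Matching points of the two tori and their orbits\<close>

text \<open>Composing the character of \<open>t\<close> with the inverse of \<open>\<Phi>\<close>
  gives a character defined on the whole lattice of rank \<open>e\<close>, so it comes directly from
  a torus point.\<close>

lemma transport_torus_element:
  assumes M: "subgroup M (monoid_vec TYPE(int) d)"
    and \<Phi>: "\<Phi> \<in> iso (monoid_vec TYPE(int) d\<lparr>carrier := M\<rparr>) (monoid_vec TYPE(int) e)"
    and t: "t \<in> carrier (torus d)"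
  obtains u where "u \<in> carrier (torus e)"
    "\<And>v. v \<in> M \<Longrightarrow> torus_monom e u (\<Phi> v) = torus_monom d t v"
proof -
  let ?G = "monoid_vec TYPE(int) d" and ?E = "monoid_vec TYPE(int) e"
  interpret G: comm_group ?G by (rule comm_group_vec)
  let ?\<Psi> = "inv_into M \<Phi>"
  have \<Psi>: "?\<Psi> \<in> hom ?E (?G\<lparr>carrier := M\<rparr>)"
    using group.iso_set_sym[OF G.subgroup_imp_group[OF M] \<Phi>] by (simp add: iso_def)
  have "torus_monom d t \<in> hom (?G\<lparr>carrier := M\<rparr>) nonzero_complex"
    using torus_monom_hom[OF t] subgroup.subset[OF M] by (auto simp: hom_def Pi_iff)
  with \<Psi> have "torus_monom d t \<circ> ?\<Psi> \<in> hom ?E nonzero_complex"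
    by (rule Group.hom_compose)
  then obtain u where u: "u \<in> carrier (torus e)"
    "\<And>v. v \<in> carrier_vec e \<Longrightarrow> torus_monom e u v = torus_monom d t (?\<Psi> v)"
    by (auto elim: ex_torus_monom_eq)
  have "torus_monom e u (\<Phi> v) = torus_monom d t v" if "v \<in> M" for v
    using u(2)[of "\<Phi> v"] \<Phi> that
    by (auto simp: iso_def bij_betw_def monoid_vec_simps)
  with u(1) show thesis by (rule that)
qed

text \<open>The character of \<open>u\<close> pulls back only to \<open>M\<close>; divisibility of
  the nonzero complex numbers extends it to the whole lattice of rank \<open>d\<close>, where it
  comes from a torus point.\<close>

lemma transport_torus_element_back:
  assumes M: "subgroup M (monoid_vec TYPE(int) d)"
    and \<Phi>: "\<Phi> \<in> hom (monoid_vec TYPE(int) d\<lparr>carrier := M\<rparr>) (monoid_vec TYPE(int) e)"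
    and u: "u \<in> carrier (torus e)"
  obtains t where "t \<in> carrier (torus d)"
    "\<And>v. v \<in> M \<Longrightarrow> torus_monom e u (\<Phi> v) = torus_monom d t v"
proof -
  let ?G = "monoid_vec TYPE(int) d"
  have \<chi>: "torus_monom e u \<circ> \<Phi> \<in> hom (?G\<lparr>carrier := M\<rparr>) nonzero_complex"
    using \<Phi> torus_monom_hom[OF u] by (rule Group.hom_compose)
  have gen: "generate ?G (unit_vec d ` {..<d}) = carrier ?G"
    by (simp add: generate_unit_vecs monoid_vec_simps)
  obtain \<psi> where \<psi>: "\<psi> \<in> hom ?G nonzero_complex" "\<And>v. v \<in> M \<Longrightarrow> \<psi> v = torus_monom e u (\<Phi> v)"
    using hom_extend_finitely_generated[OF comm_group_vec comm_group_nonzero_complex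
        nonzero_complex_divisible M \<chi> _ gen] by auto
  obtain t where t: "t \<in> carrier (torus d)" "\<And>v. v \<in> carrier_vec d \<Longrightarrow> torus_monom d t v = \<psi> v"
    using ex_torus_monom_eq[OF \<psi>(1)] by blast
  then show thesis
    using \<psi>(2) subgroup.subset[OF M] by (intro that[of t]) (auto simp: monoid_vec_simps)
qed

lemma reindex_orbit_point:
  assumes S: "set ms \<subseteq> carrier_vec d" and m: "m \<in> carrier_vec d"
    and \<sigma>: "\<sigma> permutes {..<length ms}" and len: "length ms \<le> Suc N"
    and ms': "ms' = permute_list \<sigma> (map (\<lambda>s. \<Phi> (s - m)) ms)"
    and t: "t \<in> carrier (torus d)"
    and eq: "\<And>s. s \<in> set ms \<Longrightarrow> torus_monom e u (\<Phi> (s - m)) = torus_monom d t (s - m)"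
  shows "reindex (Suc N) \<sigma> (orbit_point d N ms t) = orbit_point e N ms' u"
proof -
  have \<sigma>N: "\<sigma> permutes {..<Suc N}"
    using \<sigma> by (rule permutes_subset) (use len in auto)
  \<comment> \<open>The permutation preserves the initial segment of indices, so the padding zeros
    stay in the padding.\<close>
  have \<sigma>_less: "\<sigma> i < length ms \<longleftrightarrow> i < length ms" for i
    using permutes_in_image[OF \<sigma>, of i] by simp
  have monom: "torus_monom d t s = torus_monom d t m * torus_monom e u (\<Phi> (s - m))" if "s \<in> set ms" for s
  proof -
    have s: "s \<in> carrier_vec d" using S that by blast
    have "torus_monom d t (m + (s - m)) = torus_monom d t m * torus_monom d t (s - m)"
      using hom_mult[OF torus_monom_hom[OF t], of m "s - m"] s m by (simp add: monoid_vec_simps)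
    moreover have "m + (s - m) = s"
      using s m by (intro eq_vecI) auto
    ultimately show ?thesis
      by (simp add: eq[OF that])
  qed
  \<comment> \<open>\<open>permute_list\<close> reads its argument at position
    \<open>\<sigma> i\<close>, the same convention as \<open>reindex\<close>.\<close>
  have nth: "ms' ! i = \<Phi> (ms ! \<sigma> i - m)" if "i < length ms" for i
    using that \<sigma> \<sigma>_less by (simp add: ms' permute_list_nth)
  \<comment> \<open>The two coordinate vectors are proportional, with the value of the monomial
    \<open>m\<close> at \<open>t\<close> as the nonzero factor.\<close>
  have "vec (Suc N) (\<lambda>i. vec (Suc N) (\<lambda>i. if i < length ms then torus_monom d t (ms ! i) else 0) $ \<sigma> i) =
      torus_monom d t m \<cdot>\<^sub>v vec (Suc N) (\<lambda>i. if i < length ms' then torus_monom e u (ms' ! i) else 0)"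
    (is "_ = _ \<cdot>\<^sub>v ?w")
  proof (intro eq_vecI)
    fix i assume "i < dim_vec (torus_monom d t m \<cdot>\<^sub>v ?w)"
    then have "i < Suc N" "\<sigma> i < Suc N"
      using permutes_in_image[OF \<sigma>N, of i] by auto
    then show "vec (Suc N) (\<lambda>i. vec (Suc N) (\<lambda>i. if i < length ms then torus_monom d t (ms ! i) else 0) $ \<sigma> i) $ i =
        (torus_monom d t m \<cdot>\<^sub>v ?w) $ i"
      using monom[of "ms ! \<sigma> i"] \<sigma>_less[of i] nth[of i] by (auto simp: ms')
  qed simp
  then show ?thesis
    unfolding orbit_point_def reindex_proj_point[OF vec_carrier \<sigma>N]
    by (simp add: proj_point_smult torus_monom_nonzero[OF t])
qed

theorem corollary1p3:
  fixes d N e :: nat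
    and S :: "int vec set"
    and \<Phi> :: "int vec \<Rightarrow> int vec"
    and m :: "int vec"
    and ms ms' :: "int vec list"
  assumes "S \<subseteq> carrier_vec d"
    and "S \<noteq> {}"
    and "finite S"
    and "card S \<le> N + 1"
    and "\<Phi> \<in> iso (difference_group d S) (monoid_vec TYPE(int) e)"
    and "m \<in> S"
    and "enumerates ms S"
    and "enumerates ms' (\<Phi> ` ((\<lambda>s. s - m) ` S))"
  shows "projectively_equivalent N (X_variety d N ms) (X_variety e N ms')"
proof -
  let ?G = "monoid_vec TYPE(int) d" and ?E = "monoid_vec TYPE(int) e"
  interpret G: comm_group ?G by (rule comm_group_vec)
  define M where "M = carrier (difference_group d S)"
  have M: "subgroup M ?G"
    unfolding M_def difference_group_def by (rule G.subgroup_subgroup_generated)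
  \<comment> \<open>Rewrites the generated subgroup as the ambient group with carrier
    \<open>M\<close>, the form in which characters are extended.\<close>
  have \<Phi>: "\<Phi> \<in> iso (?G\<lparr>carrier := M\<rparr>) ?E"
    using assms(5) by (simp add: M_def difference_group_def subgroup_generated_def)
  then have \<Phi>_hom: "\<Phi> \<in> hom (?G\<lparr>carrier := M\<rparr>) ?E" and \<Phi>_inj: "inj_on \<Phi> M"
    by (auto simp: iso_def bij_betw_def)
  have diff: "s - m \<in> M" if "s \<in> S" for s
    using that assms(1,6) unfolding M_def difference_group_def carrier_subgroup_generated
    by (intro generate.incl) (auto simp: monoid_vec_simps intro!: minus_carrier_vec)
  have m: "m \<in> carrier_vec d" using assms(1,6) by blast
  have ms: "distinct ms" "set ms = S" and ms': "distinct ms'" "set ms' = \<Phi> ` (\<lambda>s. s - m) ` S"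
    using assms(7,8) by (auto simp: enumerates_def)
  have len: "length ms \<le> Suc N"
    using ms assms(4) distinct_card[OF ms(1)] by simp
  \<comment> \<open>Injectivity keeps the translated and mapped list \<open>ms\<close> free of
    repetitions. It and \<open>ms'\<close> then enumerate one set, so they differ by a
    permutation.\<close>
  have "inj_on (\<lambda>s. \<Phi> (s - m)) S"
  proof (rule inj_onI)
    fix s s' assume s: "s \<in> S" "s' \<in> S" and "\<Phi> (s - m) = \<Phi> (s' - m)"
    then have "s - m = s' - m"
      using \<Phi>_inj diff by (auto dest: inj_onD)
    moreover have "s - m + m = s" "s' - m + m = s'"
      using s m assms(1) by (auto intro!: eq_vecI)
    ultimately show "s = s'" by metis
  qed
  then have "mset ms' = mset (map (\<lambda>s. \<Phi> (s - m)) ms)"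
    using ms ms' by (intro set_eq_iff_mset_eq_distinct[THEN iffD1]) (auto simp: distinct_map)
  then obtain \<sigma> where \<sigma>: "\<sigma> permutes {..<length ms}"
    and perm: "permute_list \<sigma> (map (\<lambda>s. \<Phi> (s - m)) ms) = ms'"
    by (rule mset_eq_permutation) simp
  \<comment> \<open>The indices from \<open>length ms\<close> to \<open>N\<close> are fixed by
    \<open>\<sigma>\<close>.\<close>
  have \<sigma>N: "\<sigma> permutes {..<Suc N}"
    using \<sigma> by (rule permutes_subset) (use len in auto)
  have point: "reindex (Suc N) \<sigma> (orbit_point d N ms t) = orbit_point e N ms' u"
    if "t \<in> carrier (torus d)" "\<And>v. v \<in> M \<Longrightarrow> torus_monom e u (\<Phi> v) = torus_monom d t v" for t u
    using assms(1) ms diff that by (intro reindex_orbit_point[OF _ m \<sigma> len perm[symmetric]]) auto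
  \<comment> \<open>The orbits themselves correspond before any closure is taken; each inclusion
    uses one direction of the matching of torus points.\<close>
  have "reindex (Suc N) \<sigma> ` orbit_point d N ms ` carrier (torus d) = orbit_point e N ms' ` carrier (torus e)"
  proof (intro equalityI subsetI)
    fix p assume "p \<in> reindex (Suc N) \<sigma> ` orbit_point d N ms ` carrier (torus d)"
    then obtain t where "t \<in> carrier (torus d)" "p = reindex (Suc N) \<sigma> (orbit_point d N ms t)" by auto
    moreover obtain u where "u \<in> carrier (torus e)"
      "\<And>v. v \<in> M \<Longrightarrow> torus_monom e u (\<Phi> v) = torus_monom d t v"
      using transport_torus_element[OF M \<Phi> \<open>t \<in> carrier (torus d)\<close>] by blast
    ultimately show "p \<in> orbit_point e N ms' ` carrier (torus e)"
      using point by blast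
  next
    fix p assume "p \<in> orbit_point e N ms' ` carrier (torus e)"
    then obtain u where "u \<in> carrier (torus e)" "p = orbit_point e N ms' u" by auto
    moreover obtain t where t: "t \<in> carrier (torus d)"
      "\<And>v. v \<in> M \<Longrightarrow> torus_monom e u (\<Phi> v) = torus_monom d t v"
      using transport_torus_element_back[OF M \<Phi>_hom \<open>u \<in> carrier (torus e)\<close>] by blast
    ultimately show "p \<in> reindex (Suc N) \<sigma> ` orbit_point d N ms ` carrier (torus d)"
      using point[OF t] by blast
  qed
  moreover have "orbit_point d N ms ` carrier (torus d) \<subseteq> proj_space N"
    using orbit_point_in_proj_space assms(2) ms(2) by auto
  ultimately have "reindex (Suc N) \<sigma> ` X_variety d N ms = X_variety e N ms'"
    using reindex_zariski_closure[OF _ \<sigma>N] by (simp add: X_variety_eq)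
  then show ?thesis
    unfolding projectively_equivalent_def reindex_def
    using PGL_class_reindex_mat[OF \<sigma>N] by blast
qed

end
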